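(* Every linearly ordered compact is a co-Namioka space. That is, let $(Y,<)$ be a linearly ordered set which is compact in its order topology. Then for every Baire space $X$ and every separately continuous function $f:X\times Y\to\mathbb{R}$ there exists a dense $G_\delta$-set $A\subseteq X$ such that $f$ is (jointly) continuous at every point of $A\times Y$.
   Context: A linearly ordered compact is a linearly ordered set $(Y,<)$ equipped with the topology generated by the order (open intervals, together with the intervals $[a,y)$ and $(y,b]$ when $a=\min Y$, $b=\max Y$ exist, form a base) which is compact in this topology. A topological space is Baire if every countable intersection of dense open subsets is dense. A function $f:X\times Y\to\mathbb{R}$ on a product of topological spaces is separately continuous if for every $x\in X$ the function $y\mapsto f(x,y)$ is continuous on $Y$ and for every $y\in Y$ the function $x\mapsto f(x,y)$ is continuous on $X$. Joint continuity at a point means continuity with respect to the product topology on $X\times Y$. A separately continuous function $f:X\times Y\to\mathbb{R}$ has the Namioka property if there is a dense in $X$ $G_\delta$-set $A\subseteq X$ such that $f$ is jointly continuous at every point of $A\times Y$. A compact space $Y$ is a co-Namioka space if for every Baire space $X$ each separately continuous $f:X\times Y\to\mathbb{R}$ has the Namioka property. *)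

theory Defs
  imports "HOL-Analysis.Analysis"
begin

definition Baire_space :: "'a topology \<Rightarrow> bool" where
  "Baire_space X \<longleftrightarrow>
     (\<forall>\<U>. countable \<U> \<longrightarrow> (\<forall>U\<in>\<U>. openin X U \<and> X closure_of U = topspace X) \<longrightarrow>
        X closure_of (topspace X \<inter> \<Inter>\<U>) = topspace X)"

definition separately_continuous ::
    "'a topology \<Rightarrow> 'b topology \<Rightarrow> ('a \<times> 'b \<Rightarrow> real) \<Rightarrow> bool" where
  "separately_continuous X Y f \<longleftrightarrow>
     (\<forall>x\<in>topspace X. continuous_map Y euclideanreal (\<lambda>y. f (x, y))) \<and>
     (\<forall>y\<in>topspace Y. continuous_map X euclideanreal (\<lambda>x. f (x, y)))"

definition Namioka_property ::
    "'a topology \<Rightarrow> 'b topology \<Rightarrow> ('a \<times> 'b \<Rightarrow> real) \<Rightarrow> bool" where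
  "Namioka_property X Y f \<longleftrightarrow>
     (\<exists>A. gdelta_in X A \<and> X closure_of A = topspace X \<and>
        (\<forall>p\<in>A \<times> topspace Y. topcontinuous_at (prod_topology X Y) euclideanreal f p))"

(* A HOL formula cannot quantify over types, so the type 'a of the points of the test spaces X
   is a parameter. X ranges over all topologies on subsets of 'a; a theorem that leaves 'a
   unconstrained covers Baire spaces over every type. *)
definition co_Namioka :: "'a itself \<Rightarrow> 'b topology \<Rightarrow> bool" where
  "co_Namioka (_ :: 'a itself) Y \<longleftrightarrow>
     compact_space Y \<and>
     (\<forall>(X :: 'a topology) f. Baire_space X \<longrightarrow> separately_continuous X Y f \<longrightarrow>
        Namioka_property X Y f)"

end

theory Submission
  imports Defs
begin

text \<open>
  For \<open>e > 0\<close> consider chains \<open>y\<^sub>1 < \<dots> < y\<^sub>n\<close> in \<open>Y\<close> along which \<open>f(x, \<cdot>)\<close> jumps by more than \<open>e\<close> at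
  each step. By compactness their length is bounded for each \<open>x\<close>, and being such a chain is an
  open condition on \<open>x\<close>; so by the Baire property every nonempty open set contains a nonempty open
  \<open>V\<close> and a single chain that is of maximal length for all \<open>x \<in> V\<close>. If \<open>l < r\<close> have no chain point
  strictly between them, then \<open>f(x, \<cdot>)\<close> cannot have a spike of height \<open>2e\<close> between \<open>l\<close> and \<open>r\<close>, since
  a spike would lengthen the chain. Hence control of \<open>f\<close> near \<open>x\<^sub>0 \<in> V\<close> at three points \<open>l \<le> y \<le> r\<close>
  controls it uniformly for all points between them, so the oscillation of \<open>f\<close> is small on
  \<open>V \<times> Y\<close>.
\<close>

section \<open>Jump chains and their extension by a spike\<close>

text \<open>Jumps are required between neighbours only, so the condition splits when a list is cut
  and is restored when two lists are joined with one check at the seam. Values at distant members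
  may coincide.\<close>

definition jump_chain :: "real \<Rightarrow> ('b::linorder \<Rightarrow> real) \<Rightarrow> 'b list \<Rightarrow> bool" where
  "jump_chain e g = successively (\<lambda>u v. u < v \<and> e < \<bar>g u - g v\<bar>)"

lemma jump_chain_append:
  "jump_chain e g (as @ bs) \<longleftrightarrow> jump_chain e g as \<and> jump_chain e g bs \<and>
     (as = [] \<or> bs = [] \<or> (last as < hd bs \<and> e < \<bar>g (last as) - g (hd bs)\<bar>))"
  by (simp add: jump_chain_def successively_append_iff)

lemma jump_chain_Nil [simp]: "jump_chain e g []"
  and jump_chain_singleton [simp]: "jump_chain e g [a]"
  by (simp_all add: jump_chain_def)

lemma jump_chain_Cons:
  "jump_chain e g (a # bs) \<longleftrightarrow> jump_chain e g bs \<and>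
     (bs = [] \<or> (a < hd bs \<and> e < \<bar>g a - g (hd bs)\<bar>))"
  by (auto simp: jump_chain_def successively_Cons)

lemma jump_chain_sorted: "jump_chain e g zs \<Longrightarrow> sorted_wrt (<) zs"
  unfolding jump_chain_def
  by (subst successively_conv_sorted_wrt[symmetric])
     (auto intro: transpI elim: successively_mono)

lemma jump_chain_nth:
  "jump_chain e g zs \<Longrightarrow> Suc i < length zs \<Longrightarrow>
     zs ! i < zs ! Suc i \<and> e < \<bar>g (zs ! i) - g (zs ! Suc i)\<bar>"
  unfolding jump_chain_def by (rule successively_nth)

text \<open>As \<open>g c\<close> and \<open>g l\<close> are more than \<open>2 * e\<close> apart,
  the value at the last point of the chain is farther than \<open>e\<close> from one of them. If
  from \<open>g c\<close>, append \<open>c\<close>; if from \<open>g l\<close>, the last point lies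
  strictly below \<open>l\<close>, and both \<open>l\<close> and \<open>c\<close> can be appended.
  Either way \<open>c\<close> comes on top of at least the old length.\<close>

lemma jump_chain_snoc_spike:
  assumes as: "jump_chain e g as" and le: "\<forall>a\<in>set as. a \<le> l"
    and "l < c" and spike: "2 * e < \<bar>g c - g l\<bar>" and "0 < e"
  shows "\<exists>as'. jump_chain e g (as' @ [c]) \<and> length as \<le> length as'"
proof (cases "as = [] \<or> e < \<bar>g (last as) - g c\<bar>")
  case True
  with as le \<open>l < c\<close> have "jump_chain e g (as @ [c])"
    by (auto simp: jump_chain_append)
      (meson last_in_set le_less_trans)
  then show ?thesis by blast
next
  case False
  then have "as \<noteq> []" and "\<bar>g (last as) - g c\<bar> \<le> e" by auto
  with spike have far: "e < \<bar>g (last as) - g l\<bar>" by linarith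
  have "last as \<le> l" using le \<open>as \<noteq> []\<close> by simp
  moreover have "last as \<noteq> l" using far \<open>0 < e\<close> by auto
  ultimately have "last as < l" by simp
  with as far \<open>l < c\<close> spike \<open>0 < e\<close> have "jump_chain e g (as @ [l, c])"
    by (auto simp: jump_chain_append jump_chain_Cons abs_minus_commute)
  then show ?thesis by (intro exI[of _ "as @ [l]"]) auto
qed

text \<open>The mirror image of \<open>jump_chain_snoc_spike\<close>: here \<open>c\<close>, or
  \<open>c\<close> followed by \<open>r\<close>, is put in front.\<close>

lemma jump_chain_Cons_spike:
  assumes bs: "jump_chain e g bs" and le: "\<forall>b\<in>set bs. r \<le> b"
    and "c < r" and spike: "2 * e < \<bar>g c - g r\<bar>" and "0 < e"
  shows "\<exists>bs'. jump_chain e g (c # bs') \<and> length bs \<le> length bs'"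
proof (cases "bs = [] \<or> e < \<bar>g c - g (hd bs)\<bar>")
  case True
  with bs le \<open>c < r\<close> have "jump_chain e g (c # bs)"
    by (auto simp: jump_chain_Cons) (meson hd_in_set less_le_trans)
  then show ?thesis by blast
next
  case False
  then have "bs \<noteq> []" and "\<bar>g c - g (hd bs)\<bar> \<le> e" by auto
  with spike have far: "e < \<bar>g r - g (hd bs)\<bar>" by linarith
  have "r \<le> hd bs" using le \<open>bs \<noteq> []\<close> by simp
  moreover have "hd bs \<noteq> r" using far \<open>0 < e\<close> by auto
  ultimately have "r < hd bs" by simp
  with bs far \<open>c < r\<close> spike \<open>0 < e\<close> have "jump_chain e g (c # r # bs)"
    by (auto simp: jump_chain_Cons)
  then show ?thesis by (intro exI[of _ "r # bs"]) auto
qed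

text \<open>The gap condition cuts the chain into a part up to \<open>l\<close> and a part from
  \<open>r\<close> on. Each part can be made to meet \<open>c\<close> without getting shorter, and
  gluing at \<open>c\<close> gains at least one point.\<close>

lemma jump_chain_spike_extend:
  assumes zs: "jump_chain e g zs" and gap: "\<forall>z\<in>set zs. z \<le> l \<or> r \<le> z"
    and "l < c" "c < r" "2 * e < \<bar>g c - g l\<bar>" "2 * e < \<bar>g c - g r\<bar>" "0 < e"
  shows "\<exists>ws. jump_chain e g ws \<and> length zs < length ws"
proof -
  define as where "as = takeWhile (\<lambda>z. z \<le> l) zs"
  define bs where "bs = dropWhile (\<lambda>z. z \<le> l) zs"
  have zs_eq: "zs = as @ bs" by (simp add: as_def bs_def)
  have as: "jump_chain e g as" and bs: "jump_chain e g bs"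
    using zs by (auto simp: zs_eq jump_chain_append)
  have "\<forall>a\<in>set as. a \<le> l" by (auto simp: as_def dest: set_takeWhileD)
  then obtain as' where as': "jump_chain e g (as' @ [c])" "length as \<le> length as'"
    using jump_chain_snoc_spike[OF as] assms by blast
  \<comment> \<open>The cut by itself only says that the first point of \<open>bs\<close> is not
    below or at \<open>l\<close>; the gap lifts it to \<open>r\<close>, and monotonicity carries
    this to the rest.\<close>
  have "\<forall>b\<in>set bs. r \<le> b"
  proof (cases bs)
    case (Cons b bs')
    have "\<not> b \<le> l"
      using hd_dropWhile[of "\<lambda>z. z \<le> l" zs] Cons by (metis bs_def list.distinct(1) list.sel(1))
    moreover have "b \<in> set zs" by (simp add: zs_eq Cons)
    ultimately have "r \<le> b" using gap by auto
    then show ?thesis using jump_chain_sorted[OF bs] Cons by auto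
  qed simp
  then obtain bs' where bs': "jump_chain e g (c # bs')" "length bs \<le> length bs'"
    using jump_chain_Cons_spike[OF bs] assms by blast
  have "jump_chain e g (as' @ c # bs')"
    using as' bs' by (auto simp: jump_chain_append)
  then show ?thesis
    using as' bs' by (intro exI[of _ "as' @ c # bs'"]) (auto simp: zs_eq)
qed

section \<open>Order intervals and the bound on chain lengths\<close>

text \<open>The interval is closed because its end points are later used as test points and so must
  lie in \<open>S\<close>. The two sides of \<open>y\<close> are treated separately; an end point
  may have to be \<open>y\<close> itself, so \<open>N\<close> cannot always be taken as the open
  interval between them.\<close>

lemma open_order_interval_nbhd:
  fixes y :: "'b::linorder_topology"
  assumes "open S" "y \<in> S"
  obtains l r N where "open N" "y \<in> N" "N \<subseteq> {l..r}" "{l..r} \<subseteq> S" "l \<le> y" "y \<le> r"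
proof -
  have "\<exists>r N. open N \<and> y \<in> N \<and> N \<inter> {y..} \<subseteq> {y..r} \<and> {y..r} \<subseteq> S \<and> y \<le> r"
  proof (cases "\<exists>z. y < z")
    case False
    then show ?thesis using assms by (intro exI[of _ y] exI[of _ UNIV]) (auto simp: not_less intro: antisym)
  next
    case True
    then obtain b where b: "y < b" "{y..<b} \<subseteq> S" using open_right[OF assms] by blast
    show ?thesis
    proof (cases "\<exists>r. y < r \<and> r < b")
      case True
      then obtain r where "y < r" "r < b" by blast
      moreover have "{y..r} \<subseteq> {y..<b}" using \<open>r < b\<close> by auto
      ultimately show ?thesis using b(2) by (intro exI[of _ r] exI[of _ "{..<r}"]) auto
    next
      case False
      \<comment> \<open>Here \<open>b\<close> is the immediate successor of \<open>y\<close>, so the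
        open ray below \<open>b\<close> contains nothing above \<open>y\<close>, and
        \<open>r = y\<close> works.\<close>
      then have "{..<b} \<inter> {y..} \<subseteq> {y..y}" by (auto simp: not_less) (metis antisym leD)
      with b assms show ?thesis by (intro exI[of _ y] exI[of _ "{..<b}"]) auto
    qed
  qed
  then obtain r N1 where r: "open N1" "y \<in> N1" "N1 \<inter> {y..} \<subseteq> {y..r}" "{y..r} \<subseteq> S" "y \<le> r"
    by blast
  have "\<exists>l N. open N \<and> y \<in> N \<and> N \<inter> {..y} \<subseteq> {l..y} \<and> {l..y} \<subseteq> S \<and> l \<le> y"
  proof (cases "\<exists>z. z < y")
    case False
    then show ?thesis using assms by (intro exI[of _ y] exI[of _ UNIV]) (auto simp: not_less intro: antisym)
  next
    case True
    then obtain b where b: "b < y" "{b<..y} \<subseteq> S" using open_left[OF assms] by blast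
    show ?thesis
    proof (cases "\<exists>l. b < l \<and> l < y")
      case True
      then obtain l where "b < l" "l < y" by blast
      moreover have "{l..y} \<subseteq> {b<..y}" using \<open>b < l\<close> by auto
      ultimately show ?thesis using b(2) by (intro exI[of _ l] exI[of _ "{l<..}"]) auto
    next
      case False
      then have "{b<..} \<inter> {..y} \<subseteq> {y..y}" by (auto simp: not_less) (metis antisym leD)
      with b assms show ?thesis by (intro exI[of _ y] exI[of _ "{b<..}"]) auto
    qed
  qed
  then obtain l N2 where l: "open N2" "y \<in> N2" "N2 \<inter> {..y} \<subseteq> {l..y}" "{l..y} \<subseteq> S" "l \<le> y"
    by blast
  show ?thesis
  proof
    show "open (N1 \<inter> N2)" "y \<in> N1 \<inter> N2" "l \<le> y" "y \<le> r" using l r by auto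
    show "N1 \<inter> N2 \<subseteq> {l..r}"
    proof
      fix z assume "z \<in> N1 \<inter> N2"
      then show "z \<in> {l..r}"
        using l r by (cases "z \<le> y") (auto simp: subset_iff)
    qed
    show "{l..r} \<subseteq> S"
    proof
      fix z assume "z \<in> {l..r}"
      then show "z \<in> S" using l r by (cases "z \<le> y") (auto simp: subset_iff)
    qed
  qed
qed

text \<open>Compactness covers the space by finitely many intervals on which \<open>g\<close> varies
  by at most \<open>e\<close>. By pigeonhole a chain longer than their number has two points in one
  interval, and that interval then contains a whole jump.\<close>

lemma jump_chain_length_bounded:
  fixes g :: "'b::linorder_topology \<Rightarrow> real"
  assumes "compact (UNIV :: 'b set)" "continuous_on UNIV g" "0 < e"
  obtains n where "\<And>zs. jump_chain e g zs \<Longrightarrow> length zs \<le> n"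
proof -
  define P where "P y l r N \<longleftrightarrow> open N \<and> y \<in> N \<and> N \<subseteq> {l..r} \<and>
      (\<forall>u\<in>{l..r}. \<forall>v\<in>{l..r}. \<bar>g u - g v\<bar> \<le> e)" for y l r N
  have "\<forall>y. \<exists>l r N. P y l r N"
  proof
    fix y
    define S where "S = g -` ball (g y) (e / 2)"
    have "open S" unfolding S_def using assms(2) by (intro open_vimage) auto
    moreover have "y \<in> S" using assms(3) by (simp add: S_def)
    ultimately obtain l r N
      where N: "open N" "y \<in> N" "N \<subseteq> {l..r}" "{l..r} \<subseteq> S"
      by (rule open_order_interval_nbhd)
    have "\<bar>g u - g v\<bar> \<le> e" if "u \<in> {l..r}" "v \<in> {l..r}" for u v
    proof -
      have "u \<in> S" "v \<in> S" using N that by auto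
      then have "\<bar>g y - g u\<bar> < e / 2" "\<bar>g y - g v\<bar> < e / 2" by (simp_all add: S_def dist_real_def)
      then show ?thesis by linarith
    qed
    then show "\<exists>l r N. P y l r N"
      using N unfolding P_def by blast
  qed
  then obtain l r N where "\<And>y. P y (l y) (r y) (N y)" by metis
  then have N: "\<And>y. open (N y)" "\<And>y. y \<in> N y" "\<And>y. N y \<subseteq> {l y..r y}"
    and osc: "\<And>y u v. u \<in> {l y..r y} \<Longrightarrow> v \<in> {l y..r y} \<Longrightarrow> \<bar>g u - g v\<bar> \<le> e"
    unfolding P_def by blast+
  obtain K where K: "finite K" "UNIV \<subseteq> (\<Union>k\<in>K. N k)"
  proof (rule compactE_image[OF assms(1), of UNIV N])
    show "open (N y)" for y by (fact N(1))
    show "UNIV \<subseteq> (\<Union>k\<in>UNIV. N k)" using N(2) by auto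
  qed
  have "\<exists>k\<in>K. y \<in> {l k..r k}" for y
  proof -
    obtain k where "k \<in> K" "y \<in> N k" using K(2) by blast
    then show ?thesis using N(3) by blast
  qed
  then obtain k where k: "\<And>y. k y \<in> K" "\<And>y. y \<in> {l (k y)..r (k y)}" by metis
  have "length zs \<le> card K" if zs: "jump_chain e g zs" for zs
  proof -
    have sorted: "sorted_wrt (<) zs" using jump_chain_sorted[OF zs] .
    have neq: "k (zs ! i) \<noteq> k (zs ! j)" if "i < j" "j < length zs" for i j
    proof
      assume eq: "k (zs ! i) = k (zs ! j)"
      have step: "zs ! i < zs ! Suc i" "e < \<bar>g (zs ! i) - g (zs ! Suc i)\<bar>"
        using jump_chain_nth[OF zs, of i] that by auto
      \<comment> \<open>Convexity is what matters: the two points sharing an interval need not be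
        neighbours, but the successor of the first lies between them.\<close>
      have "zs ! Suc i \<le> zs ! j"
        using sorted_wrt_nth_less[OF sorted, of "Suc i" j] that
        by (cases "Suc i = j") auto
      with step k(2)[of "zs ! i"] k(2)[of "zs ! j"] eq
      have "zs ! Suc i \<in> {l (k (zs ! i))..r (k (zs ! i))}" by auto
      with osc k(2) step(2) show False by (meson not_le)
    qed
    have "inj_on (\<lambda>i. k (zs ! i)) {..<length zs}"
      by (rule linorder_inj_onI) (auto simp: neq)
    then have "card {..<length zs} \<le> card K"
      using k(1) K(1) by (intro card_inj_on_le) auto
    then show ?thesis by simp
  qed
  then show ?thesis using that by blast
qed

section \<open>Uniform control from three points\<close>

text \<open>A larger deviation from \<open>v\<close> would put \<open>g c\<close> more than
  \<open>2 * e\<close> away from both \<open>g l\<close> and \<open>g r\<close>, hence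
  \<open>c\<close> strictly between \<open>l\<close> and \<open>r\<close>, and the spike would
  produce a longer chain.\<close>

lemma longest_jump_chain_no_spike:
  assumes zs: "jump_chain e g zs" and longest: "\<And>ws. jump_chain e g ws \<Longrightarrow> length ws \<le> length zs"
    and gap: "\<forall>z\<in>set zs. z \<le> l \<or> r \<le> z" and "l \<le> c" "c \<le> r" "0 < e"
    and near: "\<bar>g l - v\<bar> \<le> d" "\<bar>g r - v\<bar> \<le> d"
  shows "\<bar>g c - v\<bar> \<le> d + 2 * e"
proof (rule ccontr)
  assume far: "\<not> \<bar>g c - v\<bar> \<le> d + 2 * e"
  then have spike: "2 * e < \<bar>g c - g l\<bar>" "2 * e < \<bar>g c - g r\<bar>" using near by linarith+
  then have "c \<noteq> l" "c \<noteq> r" using \<open>0 < e\<close> by auto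
  then have "l < c" "c < r" using \<open>l \<le> c\<close> \<open>c \<le> r\<close> by auto
  then show False
    using jump_chain_spike_extend[OF zs gap _ _ spike \<open>0 < e\<close>] longest by fastforce
qed

lemma openin_separately_close:
  assumes "separately_continuous X Y f" "y \<in> topspace Y"
  shows "openin X {x \<in> topspace X. \<bar>f (x, y) - t\<bar> < e}"
proof -
  have "continuous_map X euclideanreal (\<lambda>x. f (x, y))"
    using assms by (simp add: separately_continuous_def)
  moreover have "open {s :: real. \<bar>s - t\<bar> < e}"
    by (intro open_Collect_less continuous_intros)
  ultimately show ?thesis
    using openin_continuous_map_preimage[of X euclideanreal "\<lambda>x. f (x, y)" "{s. \<bar>s - t\<bar> < e}"]
    by simp
qed

lemma oscillation_le_on_stable_chain:
  fixes f :: "'a \<times> 'b::linorder_topology \<Rightarrow> real"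
  assumes f: "separately_continuous X euclidean f" and V: "openin X V" and "0 < e"
    and zs: "\<And>x. x \<in> V \<Longrightarrow> jump_chain e (\<lambda>y. f (x, y)) zs"
    and longest: "\<And>x ws. x \<in> V \<Longrightarrow> jump_chain e (\<lambda>y. f (x, y)) ws \<Longrightarrow> length ws \<le> length zs"
    and "x0 \<in> V"
  shows "\<exists>W N. openin X W \<and> x0 \<in> W \<and> open N \<and> y \<in> N \<and>
    (\<forall>x\<in>W. \<forall>c\<in>N. \<bar>f (x, c) - f (x0, y)\<bar> \<le> 4 * e)"
proof -
  have x0: "x0 \<in> topspace X" using V \<open>x0 \<in> V\<close> openin_subset by blast
  have "continuous_on UNIV (\<lambda>c. f (x0, c))"
    using f x0 by (simp add: separately_continuous_def)
  then have "open {c. \<bar>f (x0, c) - f (x0, y)\<bar> < e}"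
    by (intro open_Collect_less continuous_intros)
  \<comment> \<open>The point \<open>y\<close> may itself belong to the chain, so only the other
    chain points are kept out of the interval.\<close>
  moreover have "closed (set zs - {y})" by (simp add: finite_imp_closed)
  ultimately have "open ({c. \<bar>f (x0, c) - f (x0, y)\<bar> < e} - (set zs - {y}))"
    by (rule open_Diff)
  moreover have "y \<in> {c. \<bar>f (x0, c) - f (x0, y)\<bar> < e} - (set zs - {y})"
    using \<open>0 < e\<close> by simp
  ultimately obtain l r N where N: "open N" "y \<in> N" "N \<subseteq> {l..r}" "l \<le> y" "y \<le> r"
    and S: "{l..r} \<subseteq> {c. \<bar>f (x0, c) - f (x0, y)\<bar> < e} - (set zs - {y})"
    by (rule open_order_interval_nbhd)
  \<comment> \<open>Controlling \<open>x\<close> at three points takes only separate continuity; all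
    other points of the interval are handled by maximality of the chain.\<close>
  define W where "W = V \<inter> (\<Inter>c\<in>{l, y, r}. {x \<in> topspace X. \<bar>f (x, c) - f (x0, c)\<bar> < e})"
  have "openin X W"
    unfolding W_def using V f by (auto intro!: openin_Int openin_separately_close)
  moreover have "x0 \<in> W" using x0 \<open>x0 \<in> V\<close> \<open>0 < e\<close> by (simp add: W_def)
  moreover have "\<bar>f (x, c) - f (x0, y)\<bar> \<le> 4 * e" if "x \<in> W" "c \<in> N" for x c
  proof -
    have "x \<in> V" using that by (simp add: W_def)
    have near: "\<bar>f (x, p) - f (x0, y)\<bar> \<le> 2 * e" if "p \<in> {l, y, r}" for p
    proof -
      have "\<bar>f (x, p) - f (x0, p)\<bar> < e" using \<open>x \<in> W\<close> that by (auto simp: W_def)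
      moreover have "p \<in> {l..r}" using that N by auto
      then have "\<bar>f (x0, p) - f (x0, y)\<bar> < e" using S by blast
      ultimately show ?thesis by linarith
    qed
    have avoid: "z < l \<or> r < z \<or> z = y" if "z \<in> set zs" for z
    proof -
      have "z \<notin> {l..r} - {y}" using S that by blast
      then show ?thesis by auto
    qed
    \<comment> \<open>Splitting at \<open>y\<close> leaves two intervals without chain points
      strictly inside. Each has end values within \<open>2 * e\<close> of \<open>f (x0, y)\<close>,
      and excluding spikes costs another \<open>2 * e\<close>.\<close>
    then have "\<forall>z\<in>set zs. z \<le> l \<or> y \<le> z" "\<forall>z\<in>set zs. z \<le> y \<or> r \<le> z"
      using N(4,5) by (fastforce dest: avoid)+
    moreover have "l \<le> c" "c \<le> r" using N \<open>c \<in> N\<close> by auto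
    ultimately have "\<bar>f (x, c) - f (x0, y)\<bar> \<le> 2 * e + 2 * e"
      using longest_jump_chain_no_spike[OF zs longest, OF \<open>x \<in> V\<close> \<open>x \<in> V\<close>, of l y c "f (x0, y)" "2 * e"]
        longest_jump_chain_no_spike[OF zs longest, OF \<open>x \<in> V\<close> \<open>x \<in> V\<close>, of y r c "f (x0, y)" "2 * e"]
        near \<open>0 < e\<close> by (cases "c \<le> y") auto
    then show ?thesis by simp
  qed
  ultimately show ?thesis using N by blast
qed

section \<open>Baire category and stable chains\<close>

lemma Baire_space_dense_Inter:
  fixes D :: "nat \<Rightarrow> 'a set"
  assumes "Baire_space X" "\<And>n. openin X (D n)" "\<And>n. X closure_of D n = topspace X"
  shows "X closure_of (topspace X \<inter> \<Inter>(range D)) = topspace X"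
proof -
  have "countable (range D)" "\<forall>U\<in>range D. openin X U \<and> X closure_of U = topspace X"
    using assms(2,3) by auto
  with assms(1) show ?thesis unfolding Baire_space_def by blast
qed

text \<open>Removing from the space the boundary part of each \<open>E n\<close> leaves an open
  dense set. A point of \<open>U\<close> common to all of these lies in some \<open>E n\<close>, and
  therefore in its interior.\<close>

lemma Baire_space_closed_cover:
  fixes E :: "nat \<Rightarrow> 'a set"
  assumes "Baire_space X" and E: "\<And>n. closedin X (E n)" and cover: "topspace X \<subseteq> (\<Union>n. E n)"
    and "openin X U" "U \<noteq> {}"
  obtains n where "U \<inter> X interior_of E n \<noteq> {}"
proof -
  define D where "D n = topspace X - (E n - X interior_of E n)" for n
  have "openin X (D n)" for n
    unfolding D_def using E by (intro openin_diff closedin_diff) auto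
  moreover have "X closure_of D n = topspace X" for n
    unfolding dense_intersects_open
  proof (intro allI impI notI)
    fix T assume T: "openin X T \<and> T \<noteq> {}" and "D n \<inter> T = {}"
    then have "T \<subseteq> E n - X interior_of E n"
      using openin_subset[of X T] by (auto simp: D_def)
    then show False using T interior_of_maximal[of T "E n" X] by blast
  qed
  ultimately have "X closure_of (topspace X \<inter> \<Inter>(range D)) = topspace X"
    by (rule Baire_space_dense_Inter[OF assms(1)])
  then have "topspace X \<inter> \<Inter>(range D) \<inter> U \<noteq> {}"
    using assms unfolding dense_intersects_open by blast
  then obtain x where x: "x \<in> topspace X" "\<And>n. x \<in> D n" "x \<in> U" by blast
  then obtain n where "x \<in> E n" using cover by blast
  with x have "x \<in> U \<inter> X interior_of E n" by (auto simp: D_def)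
  then show ?thesis using that by blast
qed

text \<open>For a fixed list, the order conditions do not involve \<open>x\<close>, and what remains
  is finitely many strict inequalities between functions continuous in \<open>x\<close>.\<close>

lemma openin_jump_chain:
  fixes f :: "'a \<times> 'b::linorder_topology \<Rightarrow> real"
  assumes f: "separately_continuous X euclidean f"
  shows "openin X {x \<in> topspace X. jump_chain e (\<lambda>y. f (x, y)) zs}"
proof (induction zs)
  case Nil
  then show ?case by (simp add: jump_chain_def)
next
  case (Cons z zs)
  have "continuous_map X euclideanreal (\<lambda>x. \<bar>f (x, z) - f (x, w)\<bar>)" for w
    using f by (intro continuous_intros) (auto simp: separately_continuous_def)
  then have "openin X {x \<in> topspace X. \<bar>f (x, z) - f (x, w)\<bar> \<in> {e<..}}" for w
    by (rule openin_continuous_map_preimage) auto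
  \<comment> \<open>For empty \<open>zs\<close> the value \<open>hd zs\<close> is unspecified, but
    openness holds for any point in its place; the case distinction below discards this set.\<close>
  then have "openin X {x \<in> topspace X. e < \<bar>f (x, z) - f (x, hd zs)\<bar>}" by simp
  with Cons.IH have "openin X ({x \<in> topspace X. jump_chain e (\<lambda>y. f (x, y)) zs} \<inter>
      {x \<in> topspace X. e < \<bar>f (x, z) - f (x, hd zs)\<bar>})" by (rule openin_Int)
  moreover have "{x \<in> topspace X. jump_chain e (\<lambda>y. f (x, y)) (z # zs)} =
     (if zs = [] then topspace X else if z < hd zs then
       {x \<in> topspace X. jump_chain e (\<lambda>y. f (x, y)) zs} \<inter>
       {x \<in> topspace X. e < \<bar>f (x, z) - f (x, hd zs)\<bar>} else {})"
    by (auto simp: jump_chain_Cons)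
  ultimately show ?case by simp
qed

text \<open>The sets where chain lengths are at most \<open>n\<close> are closed and cover
  \<open>X\<close>, so one of them has interior inside \<open>U\<close>. A longest chain occurring
  over that open set remains a chain on a smaller open set, where it is still longest.\<close>

lemma exists_stable_chain:
  fixes f :: "'a \<times> 'b::linorder_topology \<Rightarrow> real"
  assumes "compact (UNIV :: 'b set)" "Baire_space X" and f: "separately_continuous X euclidean f"
    and U: "openin X U" "U \<noteq> {}" and "0 < e"
  obtains V zs where "openin X V" "V \<noteq> {}" "V \<subseteq> U"
    "\<And>x. x \<in> V \<Longrightarrow> jump_chain e (\<lambda>y. f (x, y)) zs"
    "\<And>x ws. x \<in> V \<Longrightarrow> jump_chain e (\<lambda>y. f (x, y)) ws \<Longrightarrow> length ws \<le> length zs"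
proof -
  define E where "E n = {x \<in> topspace X. \<forall>zs. jump_chain e (\<lambda>y. f (x, y)) zs \<longrightarrow> length zs \<le> n}" for n
  have "closedin X (E n)" for n
  proof -
    have "topspace X - E n =
        (\<Union>zs\<in>{zs. n < length zs}. {x \<in> topspace X. jump_chain e (\<lambda>y. f (x, y)) zs})"
      by (auto simp: E_def not_le)
    then have "openin X (topspace X - E n)" using openin_jump_chain[OF f] by auto
    then show ?thesis by (auto simp: closedin_def E_def)
  qed
  moreover have "topspace X \<subseteq> (\<Union>n. E n)"
  proof
    fix x assume x: "x \<in> topspace X"
    then have "continuous_on UNIV (\<lambda>y. f (x, y))" using f by (simp add: separately_continuous_def)
    with assms obtain n where "\<And>zs. jump_chain e (\<lambda>y. f (x, y)) zs \<Longrightarrow> length zs \<le> n"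
      using jump_chain_length_bounded by blast
    with x show "x \<in> (\<Union>n. E n)" by (auto simp: E_def)
  qed
  ultimately obtain n where n: "U \<inter> X interior_of E n \<noteq> {}"
    using Baire_space_closed_cover[OF \<open>Baire_space X\<close>] U by metis
  define U' where "U' = U \<inter> X interior_of E n"
  have U': "openin X U'" "U' \<noteq> {}" "U' \<subseteq> U" "U' \<subseteq> E n"
    using U n interior_of_subset[of X "E n"] by (auto simp: U'_def)
  \<comment> \<open>A chain counts if it is valid at some point of \<open>U'\<close>. Maximizing
    over all of these at once makes the bound independent of the point.\<close>
  define C where "C = (\<lambda>zs. \<exists>x\<in>U'. jump_chain e (\<lambda>y. f (x, y)) zs)"
  have "C []" using U' by (auto simp: C_def jump_chain_def)
  moreover have "\<forall>zs. C zs \<longrightarrow> length zs < Suc n"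
    using U' by (auto simp: C_def E_def less_Suc_eq_le)
  ultimately obtain zs where zs: "C zs" "\<forall>ws. C ws \<longrightarrow> length ws \<le> length zs"
    using ex_has_greatest_nat[of C "[]" length "Suc n"] by auto
  show ?thesis
  proof
    show "openin X (U' \<inter> {x \<in> topspace X. jump_chain e (\<lambda>y. f (x, y)) zs})"
      using U' openin_jump_chain[OF f] by auto
    show "U' \<inter> {x \<in> topspace X. jump_chain e (\<lambda>y. f (x, y)) zs} \<noteq> {}"
      using zs U' openin_subset[of X U'] by (auto simp: C_def)
  qed (use zs U' in \<open>auto simp: C_def\<close>)
qed

theorem corollary3p2:
  assumes "compact_space (euclidean :: 'b::linorder_topology topology)"
  shows "co_Namioka TYPE('a) (euclidean :: 'b topology)"
  unfolding co_Namioka_def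
proof (intro conjI allI impI)
  show "compact_space (euclidean :: 'b topology)" by (fact assms)
next
  fix X :: "'a topology" and f :: "'a \<times> 'b \<Rightarrow> real"
  assume X: "Baire_space X" and f: "separately_continuous X euclidean f"
  have compact: "compact (UNIV :: 'b set)" using assms by (simp add: compact_space_def)
  define good where "good e V \<longleftrightarrow> openin X V \<and>
      (\<forall>x0\<in>V. \<forall>y. \<exists>W N. openin X W \<and> x0 \<in> W \<and> open N \<and> y \<in> N \<and>
        (\<forall>x\<in>W. \<forall>c\<in>N. \<bar>f (x, c) - f (x0, y)\<bar> \<le> 4 * e))" for e V
  define G where "G n = \<Union>{V. good (inverse (real (Suc n))) V}" for n
  have G_open: "openin X (G n)" for n by (auto simp: G_def good_def)
  have "X closure_of G n = topspace X" for n
    unfolding dense_intersects_open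
  proof (intro allI impI)
    fix U assume U: "openin X U \<and> U \<noteq> {}"
    obtain V zs where V: "openin X V" "V \<noteq> {}" "V \<subseteq> U"
      and zs: "\<And>x. x \<in> V \<Longrightarrow> jump_chain (inverse (real (Suc n))) (\<lambda>y. f (x, y)) zs"
        "\<And>x ws. x \<in> V \<Longrightarrow> jump_chain (inverse (real (Suc n))) (\<lambda>y. f (x, y)) ws \<Longrightarrow>
           length ws \<le> length zs"
      using exists_stable_chain[OF compact X f, of U "inverse (real (Suc n))"] U by auto
    have "good (inverse (real (Suc n))) V"
      unfolding good_def using V(1)
      by (intro conjI ballI allI oscillation_le_on_stable_chain[OF f V(1) _ zs(1) zs(2)]) auto
    then show "G n \<inter> U \<noteq> {}" using V by (auto simp: G_def)
  qed
  with G_open have dense: "X closure_of (topspace X \<inter> \<Inter>(range G)) = topspace X"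
    by (rule Baire_space_dense_Inter[OF X])
  show "Namioka_property X euclidean f"
    unfolding Namioka_property_def
  proof (intro exI conjI ballI)
    show "gdelta_in X (topspace X \<inter> \<Inter>(range G))"
    proof (rule gdelta_in_Int)
      show "gdelta_in X (\<Inter>(range G))"
        by (rule gdelta_in_Inter) (use G_open open_imp_gdelta_in in auto)
    qed simp
    show "X closure_of (topspace X \<inter> \<Inter>(range G)) = topspace X" by (fact dense)
    fix p assume "p \<in> (topspace X \<inter> \<Inter>(range G)) \<times> topspace (euclidean :: 'b topology)"
    then obtain x0 y where p: "p = (x0, y)" "x0 \<in> topspace X" and G: "\<And>n. x0 \<in> G n" by auto
    show "topcontinuous_at (prod_topology X euclidean) euclideanreal f p"
      unfolding topcontinuous_at_def
    proof (intro conjI allI impI ballI)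
      show "p \<in> topspace (prod_topology X euclidean)" using p by simp
      fix S assume "openin euclideanreal S \<and> f p \<in> S"
      then obtain d where d: "0 < d" "ball (f p) d \<subseteq> S" by (auto simp: open_contains_ball)
      obtain n where n: "inverse (real (Suc n)) < d / 4"
        using reals_Archimedean[of "d / 4"] d by auto
      obtain W N where WN: "openin X W" "x0 \<in> W" "open N" "y \<in> N"
        and close: "\<And>x c. x \<in> W \<Longrightarrow> c \<in> N \<Longrightarrow> \<bar>f (x, c) - f (x0, y)\<bar> \<le> 4 * inverse (real (Suc n))"
      proof -
        obtain V where "good (inverse (real (Suc n))) V" "x0 \<in> V"
          using G[of n] by (auto simp: G_def)
        then have "\<exists>W N. openin X W \<and> x0 \<in> W \<and> open N \<and> y \<in> N \<and>
            (\<forall>x\<in>W. \<forall>c\<in>N. \<bar>f (x, c) - f (x0, y)\<bar> \<le> 4 * inverse (real (Suc n)))"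
          unfolding good_def by (elim conjE) (drule (1) bspec, erule spec)
        then show ?thesis using that by blast
      qed
      have "f q \<in> S" if "q \<in> W \<times> N" for q
      proof -
        have "\<bar>f q - f p\<bar> < d" using close[of "fst q" "snd q"] that n p by (auto simp: mem_Times_iff)
        then have "f q \<in> ball (f p) d" by (simp add: dist_real_def abs_minus_commute)
        then show ?thesis using d by blast
      qed
      moreover have "openin (prod_topology X euclidean) (W \<times> N)"
        using WN by (simp add: openin_prod_Times_iff)
      ultimately show "\<exists>T. openin (prod_topology X euclidean) T \<and> p \<in> T \<and> (\<forall>q\<in>T. f q \<in> S)"
        using WN p by (intro exI[of _ "W \<times> N"]) auto
    qed auto
  qed
qed

end
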